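(* There exists an absolute constant $C>0$ such that for every integer $d\ge 1$, every integer $m$ with $1\le m\le d$, and every unconditional convex body $K\subset\mathbb{R}^d$ with $\dim(K\cap\mathbb{Z}^d)=d$, $$\#K \;\le\; (Cd)^{d-m}\, \max\{\#(K\cap H): H\in \mathrm{G}_{\mathbb{Z}}(m,d)\}\; \mathrm{vol}_d(K)^{\frac{d-m}{d}}.$$
   Context: A convex body in $\mathbb{R}^d$ is a convex compact subset equal to the closure of its interior. A set $K\subset\mathbb{R}^d$ is unconditional if $(\pm x_1,\pm x_2,\dots,\pm x_d)\in K$ for every $x=(x_1,\dots,x_d)\in K$ and every choice of signs. For a set $A\subset\mathbb{R}^d$, $\#A=\mathrm{card}(A\cap\mathbb{Z}^d)$ and $\dim(A)$ is the dimension of the affine hull of $A$; thus, for such $K$, $\dim(K\cap\mathbb{Z}^d)=d$ means that $K$ contains $d$ linearly independent points of $\mathbb{Z}^d$. $\mathrm{vol}_d$ is $d$-dimensional volume. $\mathrm{G}_{\mathbb{Z}}(m,d)$ is the set of all $m$-dimensional linear subspaces of $\mathbb{R}^d$ containing $m$ linearly independent vectors of $\mathbb{Z}^d$. *)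

theory Defs
  imports "HOL-Analysis.Analysis" "HOL-Library.Function_Algebras"
begin

text \<open>
  The dimension \<open>d\<close> is quantified after the absolute constant, so it cannot be a type.
  The space of dimension \<open>d\<close> is \<^const>\<open>Euclidean_space\<close> \<open>d\<close> from the library: the functions
  of type \<open>nat \<Rightarrow> real\<close> that vanish at every index \<open>i \<ge> d\<close>, with the product topology. The
  pointwise real vector space structure below makes \<^const>\<open>convex\<close>, \<^const>\<open>subspace\<close>,
  \<^const>\<open>independent\<close>, \<^const>\<open>dim\<close> and the affine hull available on that type.
\<close>

instantiation "fun" :: (type, real_vector) real_vector
begin

definition scaleR_fun :: "real \<Rightarrow> ('a \<Rightarrow> 'b) \<Rightarrow> 'a \<Rightarrow> 'b"
  where "scaleR_fun c f = (\<lambda>x. c *\<^sub>R f x)"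

instance
  by standard (simp_all add: scaleR_fun_def fun_eq_iff scaleR_add_right scaleR_add_left)

end

definition convex_body :: "nat \<Rightarrow> (nat \<Rightarrow> real) set \<Rightarrow> bool"
  where "convex_body d K \<longleftrightarrow>
    compactin (Euclidean_space d) K \<and> convex K \<and>
    Euclidean_space d closure_of (Euclidean_space d interior_of K) = K"

text \<open>
  Signs at indices \<open>i \<ge> d\<close> have no effect on elements of \<open>Euclidean_space d\<close>, so no bound
  on the index is needed.
\<close>

definition unconditional :: "(nat \<Rightarrow> real) set \<Rightarrow> bool"
  where "unconditional K \<longleftrightarrow>
    (\<forall>x\<in>K. \<forall>\<epsilon>. (\<forall>i. \<epsilon> i \<in> {-1, 1}) \<longrightarrow> (\<lambda>i. \<epsilon> i * x i) \<in> K)"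

definition int_lattice :: "nat \<Rightarrow> (nat \<Rightarrow> real) set"
  where "int_lattice d = {x \<in> topspace (Euclidean_space d). \<forall>i. x i \<in> \<int>}"

definition lattice_count :: "nat \<Rightarrow> (nat \<Rightarrow> real) set \<Rightarrow> nat"
  where "lattice_count d A = card (A \<inter> int_lattice d)"

text \<open>
  The dimension of the affine hull, that is, of its direction space. The library constant
  \<^const>\<open>aff_dim\<close> is restricted to the class \<^class>\<open>euclidean_space\<close>. The empty set gets the
  value 0 here, not -1.
\<close>

definition affine_hull_dim :: "'a::real_vector set \<Rightarrow> nat"
  where "affine_hull_dim A = dim {x - y |x y. x \<in> affine hull A \<and> y \<in> affine hull A}"

text \<open>
  Lebesgue measure on \<open>d\<close> coordinates. Functions in the space of the product measure are
  \<^const>\<open>undefined\<close> outside \<open>{..<d}\<close> instead of 0, hence the restriction.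
\<close>

definition vol :: "nat \<Rightarrow> (nat \<Rightarrow> real) set \<Rightarrow> real"
  where "vol d A = measure (Pi\<^sub>M {..<d} (\<lambda>_. lborel)) ((\<lambda>x. restrict x {..<d}) ` A)"

definition lattice_subspaces :: "nat \<Rightarrow> nat \<Rightarrow> (nat \<Rightarrow> real) set set"
  where "lattice_subspaces m d =
    {H. H \<subseteq> topspace (Euclidean_space d) \<and> subspace H \<and> dim H = m \<and>
        (\<exists>B \<subseteq> H \<inter> int_lattice d. finite B \<and> card B = m \<and> independent B)}"

end

theory Submission
  imports Defs
begin

text \<open>
  Let \<open>a\<^sub>i\<close> be the largest \<open>i\<close>-th coordinate of a lattice point of \<open>K\<close>. The dimension hypothesis
  gives \<open>a\<^sub>i \<ge> 1\<close>, and unconditionality gives \<open>\<plusminus>a\<^sub>i e\<^sub>i \<in> K\<close>, so \<open>K\<close> contains the box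
  \<open>\<Prod>[-a\<^sub>i/d, a\<^sub>i/d]\<close> and \<open>\<Prod>a\<^sub>i \<le> (d/2)^d vol K\<close>. Let \<open>I\<close> consist of \<open>d - m\<close> indices with the
  smallest \<open>a\<^sub>i\<close>, and let \<open>H\<close> be the coordinate subspace \<open>x\<^sub>I = 0\<close>. Setting the coordinates in
  \<open>I\<close> to zero maps \<open>K \<inter> \<int>^d\<close> to \<open>K \<inter> H \<inter> \<int>^d\<close> with fibres of size at most
  \<open>\<Prod>\<^sub>I (2a\<^sub>i + 1) \<le> 3^(d-m) \<Prod>\<^sub>I a\<^sub>i\<close>, and \<open>\<Prod>\<^sub>I a\<^sub>i \<le> (\<Prod>a\<^sub>i)^((d-m)/d)\<close> by the choice of \<open>I\<close>.
  This gives \<open>C = 3/2\<close>.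
\<close>

section \<open>Coordinate subspaces and the dimension hypothesis\<close>

definition unit_fun :: "nat \<Rightarrow> nat \<Rightarrow> real"
  where "unit_fun i = (\<lambda>j. if j = i then 1 else 0)"

text \<open>The ambient dimension does not appear: every coordinate outside \<open>J\<close>
  vanishes, so \<open>J \<subseteq> {..<d}\<close> already places the set inside
  \<open>Euclidean_space d\<close>.\<close>

definition coord_space :: "nat set \<Rightarrow> (nat \<Rightarrow> real) set"
  where "coord_space J = {x. \<forall>j. j \<notin> J \<longrightarrow> x j = 0}"

lemma inj_unit_fun: "inj unit_fun"
  by (rule injI) (metis unit_fun_def zero_neq_one)

lemma sum_scaleR_fun_apply:
  fixes g :: "'b \<Rightarrow> 'a \<Rightarrow> real"
  shows "(\<Sum>i\<in>J. c i *\<^sub>R g i) j = (\<Sum>i\<in>J. c i * g i j)"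
  by (induction J rule: infinite_finite_induct) (simp_all add: scaleR_fun_def)

lemma subspace_coord_space: "subspace (coord_space J)"
  by (rule subspaceI) (auto simp: coord_space_def scaleR_fun_def)

text \<open>A point of the left side is the combination of unit vectors weighted by its own
  coordinates. Finiteness of \<open>J\<close> matters, since a span contains only finite
  combinations.\<close>

lemma coord_space_eq_span:
  assumes "finite J"
  shows "coord_space J = span (unit_fun ` J)"
proof
  show "span (unit_fun ` J) \<subseteq> coord_space J"
    by (intro span_minimal subspace_coord_space) (auto simp: coord_space_def unit_fun_def)
  show "coord_space J \<subseteq> span (unit_fun ` J)"
  proof
    fix x assume x: "x \<in> coord_space J"
    have "x = (\<Sum>i\<in>J. x i *\<^sub>R unit_fun i)"
      using x assms
      by (auto simp: fun_eq_iff sum_scaleR_fun_apply unit_fun_def coord_space_def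
          if_distrib[of "(*) _"] sum.delta cong: if_cong)
    also have "\<dots> \<in> span (unit_fun ` J)"
      by (intro span_sum span_scale span_base) auto
    finally show "x \<in> span (unit_fun ` J)" .
  qed
qed

text \<open>A unit vector in the span of the others would lie in
  \<open>coord_space (J - {i})\<close>, where its own coordinate is 0 instead of 1.\<close>

lemma independent_unit_fun:
  assumes "finite J"
  shows "independent (unit_fun ` J)"
proof
  assume "dependent (unit_fun ` J)"
  then obtain i where i: "i \<in> J" "unit_fun i \<in> span (unit_fun ` J - {unit_fun i})"
    by (auto simp: dependent_def)
  have "unit_fun ` J - {unit_fun i} = unit_fun ` (J - {i})"
    using inj_unit_fun by (auto simp: inj_def)
  with i assms have "unit_fun i \<in> coord_space (J - {i})"
    by (simp add: coord_space_eq_span)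
  then show False
    by (auto simp: coord_space_def unit_fun_def)
qed

text \<open>The unit vectors are lattice points, so one basis yields both the dimension and the
  required independent lattice vectors. This makes coordinate subspaces candidates for the maximum
  in the theorem.\<close>

lemma coord_space_in_lattice_subspaces:
  assumes "J \<subseteq> {..<d}"
  shows "coord_space J \<in> lattice_subspaces (card J) d"
proof -
  have fin: "finite J"
    using assms finite_subset by blast
  have card: "card (unit_fun ` J) = card J"
    by (rule card_image) (meson inj_unit_fun inj_on_subset subset_UNIV)
  have "unit_fun ` J \<subseteq> coord_space J \<inter> int_lattice d"
    using assms
    by (auto simp: coord_space_def int_lattice_def topspace_Euclidean_space unit_fun_def)
  moreover have "dim (coord_space J) = card J"
    using fin card independent_unit_fun[OF fin]
    by (simp add: coord_space_eq_span dim_eq_card_independent)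
  moreover have "coord_space J \<subseteq> topspace (Euclidean_space d)"
    using assms by (auto simp: coord_space_def topspace_Euclidean_space)
  ultimately show ?thesis
    unfolding lattice_subspaces_def
    using subspace_coord_space independent_unit_fun[OF fin] card fin by blast
qed

text \<open>Otherwise \<open>A\<close>, its affine hull and all differences would lie in a
  coordinate subspace spanned by \<open>d - 1\<close> unit vectors. The dimension hypothesis enters
  the proof only through this lemma.\<close>

lemma exists_nonzero_coordinate:
  assumes dim: "affine_hull_dim A = d" and A: "A \<subseteq> topspace (Euclidean_space d)" and i: "i < d"
  shows "\<exists>x\<in>A. x i \<noteq> 0"
proof (rule ccontr)
  let ?J = "{..<d} - {i}"
  assume "\<not> ?thesis"
  with A have "A \<subseteq> coord_space ?J"
    by (force simp: coord_space_def topspace_Euclidean_space)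
  then have "affine hull A \<subseteq> coord_space ?J"
    by (metis hull_minimal subspace_imp_affine subspace_coord_space)
  then have "{x - y |x y. x \<in> affine hull A \<and> y \<in> affine hull A} \<subseteq> coord_space ?J"
    using subspace_diff[OF subspace_coord_space] by blast
  also have "coord_space ?J = span (unit_fun ` ?J)"
    by (simp add: coord_space_eq_span)
  finally have "affine_hull_dim A \<le> card (unit_fun ` ?J)"
    unfolding affine_hull_dim_def by (rule dim_le_card) simp
  also have "\<dots> \<le> card ?J"
    by (rule card_image_le) simp
  finally show False
    using dim i by simp
qed

section \<open>Points forced into an unconditional convex set\<close>

text \<open>Averaging \<open>x\<close> with its reflection in the coordinates outside
  \<open>J\<close> cancels exactly those coordinates.\<close>

lemma unconditional_zero_coords:
  assumes "unconditional K" "convex K" "x \<in> K"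
  shows "(\<lambda>j. if j \<in> J then x j else 0) \<in> K"
proof -
  let ?\<epsilon> = "\<lambda>j. if j \<in> J then 1 else -1 :: real"
  have "(\<lambda>j. ?\<epsilon> j * x j) \<in> K"
    using assms unfolding unconditional_def by auto
  then have "(1/2) *\<^sub>R x + (1/2) *\<^sub>R (\<lambda>j. ?\<epsilon> j * x j) \<in> K"
    using assms by (intro convexD) auto
  also have "(1/2) *\<^sub>R x + (1/2) *\<^sub>R (\<lambda>j. ?\<epsilon> j * x j) = (\<lambda>j. if j \<in> J then x j else 0)"
    by (auto simp: fun_eq_iff scaleR_fun_def)
  finally show ?thesis .
qed

text \<open>Zeroing all other coordinates and flipping the sign puts both endpoints
  \<open>x i\<close> and \<open>- x i\<close> of the axis segment into \<open>K\<close>; convexity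
  fills in the rest.\<close>

lemma unconditional_axis_segment:
  assumes K: "unconditional K" "convex K" "x \<in> K" and t: "\<bar>t\<bar> \<le> \<bar>x i\<bar>"
  shows "t *\<^sub>R unit_fun i \<in> K"
proof -
  have "(\<lambda>j. if j \<in> {i} then x j else 0) \<in> K"
    using K by (rule unconditional_zero_coords)
  moreover have "(\<lambda>j. if j \<in> {i} then x j else 0) = x i *\<^sub>R unit_fun i"
    by (auto simp: fun_eq_iff scaleR_fun_def unit_fun_def)
  ultimately have p: "x i *\<^sub>R unit_fun i \<in> K"
    by simp
  then have "(\<lambda>j. -1 * (x i *\<^sub>R unit_fun i) j) \<in> K"
    using K(1)[unfolded unconditional_def, rule_format, OF p, of "\<lambda>_. -1"] by simp
  moreover have "(\<lambda>j. -1 * (x i *\<^sub>R unit_fun i) j) = (- x i) *\<^sub>R unit_fun i"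
    by (auto simp: fun_eq_iff scaleR_fun_def)
  ultimately have n: "(- x i) *\<^sub>R unit_fun i \<in> K"
    by simp
  show ?thesis
  proof (cases "x i = 0")
    case False
    \<comment> \<open>\<open>s\<close> is the position of \<open>t\<close> relative to the
      endpoints, rescaled to the interval from -1 to 1; the weights of the convex combination are
      then \<open>(1 + s) / 2\<close> and \<open>(1 - s) / 2\<close>.\<close>
    define s where "s = t / x i"
    have "\<bar>s\<bar> \<le> 1"
      using t False by (simp add: s_def abs_divide divide_le_eq)
    then have "((1 + s) / 2) *\<^sub>R (x i *\<^sub>R unit_fun i) + ((1 - s) / 2) *\<^sub>R ((- x i) *\<^sub>R unit_fun i) \<in> K"
      using K p n by (intro convexD) (auto simp: field_simps)
    also have "((1 + s) / 2) *\<^sub>R (x i *\<^sub>R unit_fun i) + ((1 - s) / 2) *\<^sub>R ((- x i) *\<^sub>R unit_fun i)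
        = t *\<^sub>R unit_fun i"
      using False by (auto simp: fun_eq_iff scaleR_fun_def s_def field_simps)
    finally show ?thesis .
  qed (use p t in simp)
qed

text \<open>\<open>x\<close> is the average of the \<open>d\<close> axis points
  \<open>(d * x i) *\<^sub>R unit_fun i\<close>, each of which lies on a segment in
  \<open>K\<close>. The averaging costs the factor \<open>d\<close> in the side lengths.\<close>

lemma convex_unconditional_contains_box:
  assumes K: "convex K" and d: "d \<ge> 1"
    and seg: "\<And>i t. i < d \<Longrightarrow> \<bar>t\<bar> \<le> a i \<Longrightarrow> t *\<^sub>R unit_fun i \<in> K"
    and x: "\<And>i. i < d \<Longrightarrow> \<bar>x i\<bar> \<le> a i / real d" and x0: "\<And>i. i \<ge> d \<Longrightarrow> x i = 0"
  shows "x \<in> K"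
proof -
  have "\<bar>real d * x i\<bar> \<le> a i" if "i < d" for i
    using x[OF that] d by (simp add: abs_mult field_simps)
  then have "(\<Sum>i<d. (1 / real d) *\<^sub>R ((real d * x i) *\<^sub>R unit_fun i)) \<in> K"
    using d by (intro convex_sum K seg) auto
  also have "(\<Sum>i<d. (1 / real d) *\<^sub>R ((real d * x i) *\<^sub>R unit_fun i)) = x"
  proof
    fix j
    have "(\<Sum>i<d. (1 / real d) *\<^sub>R ((real d * x i) *\<^sub>R unit_fun i)) j
        = (\<Sum>i<d. if i = j then x i else 0)"
      using d unfolding sum_scaleR_fun_apply
      by (intro sum.cong) (auto simp: scaleR_fun_def unit_fun_def)
    also have "\<dots> = x j"
      using x0[of j] by (auto simp: sum.delta')
    finally show "(\<Sum>i<d. (1 / real d) *\<^sub>R ((real d * x i) *\<^sub>R unit_fun i)) j = x j" .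
  qed
  finally show ?thesis .
qed

section \<open>Boundedness and finiteness of the lattice points\<close>

text \<open>\<open>Euclidean_space d\<close> carries the subspace topology of the product topology,
  which is the topology of the function type.\<close>

lemma compact_if_convex_body:
  assumes "convex_body d K"
  shows "compact K"
  using assms unfolding convex_body_def Euclidean_space_def
  by (simp add: compactin_subtopology euclidean_product_topology)

lemma convex_body_subset:
  assumes "convex_body d K"
  shows "K \<subseteq> topspace (Euclidean_space d)"
  using assms unfolding convex_body_def by (meson compactin_subset_topspace)

lemma compact_coordinate_bound:
  fixes K :: "(nat \<Rightarrow> real) set"
  assumes "compact K"
  shows "\<exists>R. \<forall>x\<in>K. \<forall>i<d. \<bar>x i\<bar> \<le> R"
proof -
  have "\<exists>r. \<forall>x\<in>K. \<bar>x i\<bar> \<le> r" for i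
  proof -
    have "continuous_on K (\<lambda>x::nat \<Rightarrow> real. x i)"
      by (rule continuous_on_subset[OF continuous_on_product_coordinates]) simp
    then have "bounded ((\<lambda>x. x i) ` K)"
      using assms compact_continuous_image compact_imp_bounded by blast
    then show ?thesis
      by (auto simp: bounded_iff)
  qed
  then obtain r where r: "\<And>i x. x \<in> K \<Longrightarrow> \<bar>x i\<bar> \<le> r i"
    by metis
  \<comment> \<open>A sum serves as the common bound in place of a maximum, so \<open>d = 0\<close>
    needs no separate treatment.\<close>
  have "\<bar>x i\<bar> \<le> (\<Sum>j<d. \<bar>r j\<bar>)" if "x \<in> K" "i < d" for x i
  proof -
    have "\<bar>x i\<bar> \<le> \<bar>r i\<bar>"
      using r[OF that(1), of i] by linarith
    also have "\<dots> \<le> (\<Sum>j<d. \<bar>r j\<bar>)"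
      using that by (intro member_le_sum) auto
    finally show ?thesis .
  qed
  then show ?thesis
    by blast
qed

lemma card_int_interval:
  "card {z \<in> \<int>. \<bar>z\<bar> \<le> real n} = 2 * n + 1" "finite {z \<in> \<int>. \<bar>z\<bar> \<le> real n}"
proof -
  have "{z \<in> \<int>. \<bar>z\<bar> \<le> real n} = real_of_int ` {- int n..int n}"
  proof (intro equalityI subsetI)
    fix z :: real assume "z \<in> {z \<in> \<int>. \<bar>z\<bar> \<le> real n}"
    then obtain k where "z = of_int k" "\<bar>real_of_int k\<bar> \<le> real n"
      by (auto elim: Ints_cases)
    moreover from this have "k \<in> {- int n..int n}"
      by (simp; linarith)
    ultimately show "z \<in> real_of_int ` {- int n..int n}"
      by blast
  next
    fix z assume "z \<in> real_of_int ` {- int n..int n}"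
    then obtain k where "z = of_int k" "- int n \<le> k" "k \<le> int n"
      by auto
    then show "z \<in> {z \<in> \<int>. \<bar>z\<bar> \<le> real n}"
      by (simp; linarith)
  qed
  then show "card {z \<in> \<int>. \<bar>z\<bar> \<le> real n} = 2 * n + 1" "finite {z \<in> \<int>. \<bar>z\<bar> \<le> real n}"
    by (simp_all add: card_image inj_on_def)
qed

text \<open>The forgotten coordinates are all 0. Finiteness can thus be checked among the
  extensional functions of \<open>Pi\<^sub>E\<close>.\<close>

lemma inj_on_restrict_Euclidean: "inj_on (\<lambda>x. restrict x {..<d}) (topspace (Euclidean_space d))"
proof (rule inj_onI)
  fix x y :: "nat \<Rightarrow> real"
  assume x: "x \<in> topspace (Euclidean_space d)" and y: "y \<in> topspace (Euclidean_space d)"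
    and eq: "restrict x {..<d} = restrict y {..<d}"
  show "x = y"
  proof
    fix i
    show "x i = y i"
      using x y fun_cong[OF eq, of i] by (cases "i < d") (auto simp: topspace_Euclidean_space)
  qed
qed

lemma finite_lattice_points:
  assumes "convex_body d K"
  shows "finite (K \<inter> int_lattice d)"
proof -
  obtain R where R: "\<And>x i. x \<in> K \<Longrightarrow> i < d \<Longrightarrow> \<bar>x i\<bar> \<le> R"
    using compact_coordinate_bound[OF compact_if_convex_body[OF assms]] by blast
  obtain n where n: "R \<le> real n"
    using real_arch_simple by blast
  let ?f = "\<lambda>x::nat \<Rightarrow> real. restrict x {..<d}"
  have "?f ` (K \<inter> int_lattice d) \<subseteq> Pi\<^sub>E {..<d} (\<lambda>_. {z \<in> \<int>. \<bar>z\<bar> \<le> real n})"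
    using R n by (force simp: int_lattice_def)
  then have "finite (?f ` (K \<inter> int_lattice d))"
    by (rule finite_subset) (intro finite_PiE card_int_interval finite_lessThan)
  moreover have "inj_on ?f (K \<inter> int_lattice d)"
    by (rule inj_on_subset[OF inj_on_restrict_Euclidean]) (auto simp: int_lattice_def)
  ultimately show ?thesis
    using finite_imageD by blast
qed

section \<open>Counting lattice points by fibres of a coordinate projection\<close>

text \<open>A lattice point is determined by its projection, which stays in \<open>K\<close> by
  unconditionality, together with its coordinates in \<open>I\<close>. The factor
  \<open>2 * a i + 1\<close> counts the integers of absolute value at most
  \<open>a i\<close>.\<close>

lemma lattice_count_le_fibres:
  assumes K: "unconditional K" "convex K" and fin: "finite (K \<inter> int_lattice d)"
    and I: "I \<subseteq> {..<d}"
    and a: "\<And>x i. x \<in> K \<inter> int_lattice d \<Longrightarrow> i \<in> I \<Longrightarrow> \<bar>x i\<bar> \<le> real (a i)"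
  shows "lattice_count d K
    \<le> lattice_count d (K \<inter> coord_space ({..<d} - I)) * (\<Prod>i\<in>I. 2 * a i + 1)"
proof -
  have finI: "finite I"
    using I finite_subset by blast
  let ?A = "K \<inter> coord_space ({..<d} - I) \<inter> int_lattice d"
  let ?B = "Pi\<^sub>E I (\<lambda>i. {z \<in> \<int>. \<bar>z\<bar> \<le> real (a i)})"
  \<comment> \<open>Keeping the coordinates in \<open>- I\<close> rather than in
    \<open>{..<d} - I\<close> makes the two components recover every index, so injectivity does not
    involve \<open>d\<close>.\<close>
  let ?f = "\<lambda>x::nat \<Rightarrow> real. (\<lambda>j. if j \<in> - I then x j else 0, restrict x I)"
  have image: "?f ` (K \<inter> int_lattice d) \<subseteq> ?A \<times> ?B"
  proof (rule image_subsetI)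
    fix x assume x: "x \<in> K \<inter> int_lattice d"
    have "(\<lambda>j. if j \<in> - I then x j else 0) \<in> K"
      using K x by (intro unconditional_zero_coords) auto
    moreover have "(\<lambda>j. if j \<in> - I then x j else 0) \<in> coord_space ({..<d} - I) \<inter> int_lattice d"
      using x by (auto simp: coord_space_def int_lattice_def topspace_Euclidean_space)
    moreover have "restrict x I \<in> ?B"
      using a[OF x] x by (intro restrict_PiE_iff[THEN iffD2]) (auto simp: int_lattice_def)
    ultimately show "?f x \<in> ?A \<times> ?B"
      by (intro SigmaI) auto
  qed
  have inj: "inj_on ?f (K \<inter> int_lattice d)"
  proof (rule inj_onI)
    fix x y assume "?f x = ?f y"
    then have *: "(\<lambda>j. if j \<in> - I then x j else 0) = (\<lambda>j. if j \<in> - I then y j else 0)"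
        "restrict x I = restrict y I"
      by (simp_all only: prod.inject)
    show "x = y"
    proof
      fix j show "x j = y j"
        using fun_cong[OF *(1), of j] fun_cong[OF *(2), of j] by (auto split: if_splits)
    qed
  qed
  have "finite (?A \<times> ?B)"
  proof (rule finite_cartesian_product)
    show "finite ?A"
      by (rule finite_subset[OF _ fin]) blast
    show "finite ?B"
      by (intro finite_PiE finI card_int_interval)
  qed
  then have "card (K \<inter> int_lattice d) \<le> card (?A \<times> ?B)"
    by (rule card_inj_on_le[OF inj image])
  then show ?thesis
    by (simp only: lattice_count_def card_cartesian_product card_PiE[OF finI] card_int_interval)
qed

section \<open>Volume bounded below by an inscribed box\<close>

text \<open>The restricted image equals the preimage of \<open>K\<close> under extension by zero.
  That map is measurable, and a compact \<open>K\<close> is Borel in the countable product.\<close>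

lemma sets_restrict_compact:
  assumes "compact K" "K \<subseteq> topspace (Euclidean_space d)"
  shows "(\<lambda>x. restrict x {..<d}) ` K \<in> sets (Pi\<^sub>M {..<d} (\<lambda>_. lborel))"
proof -
  let ?M = "Pi\<^sub>M {..<d} (\<lambda>_. lborel :: real measure)"
  let ?ext = "\<lambda>y i. if i < d then y i else 0 :: real"
  have "?ext \<in> measurable ?M (Pi\<^sub>M UNIV (\<lambda>_. borel))"
  proof (rule measurable_PiM_single')
    fix i :: nat
    show "(\<lambda>y. ?ext y i) \<in> measurable ?M borel"
    proof (cases "i < d")
      case True
      then have "(\<lambda>y. y i) \<in> measurable ?M lborel"
        by (intro measurable_component_singleton) simp
      with True show ?thesis
        by simp
    qed simp
  qed simp
  moreover have "K \<in> sets (Pi\<^sub>M UNIV (\<lambda>_::nat. borel :: real measure))"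
    using assms(1) by (simp add: sets_PiM_equal_borel borel_compact)
  ultimately have "?ext -` K \<inter> space ?M \<in> sets ?M"
    by (rule measurable_sets)
  also have "?ext -` K \<inter> space ?M = (\<lambda>x. restrict x {..<d}) ` K"
  proof (intro equalityI subsetI)
    fix y assume y: "y \<in> ?ext -` K \<inter> space ?M"
    then have "y = restrict (?ext y) {..<d}"
      by (auto simp: fun_eq_iff space_PiM PiE_def extensional_def)
    with y show "y \<in> (\<lambda>x. restrict x {..<d}) ` K"
      by blast
  next
    fix y assume "y \<in> (\<lambda>x. restrict x {..<d}) ` K"
    then obtain x where x: "x \<in> K" "y = restrict x {..<d}"
      by blast
    then have "?ext y = x"
      using assms(2) by (auto simp: fun_eq_iff topspace_Euclidean_space)
    with x show "y \<in> ?ext -` K \<inter> space ?M"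
      by (auto simp: space_PiM)
  qed
  finally show ?thesis .
qed

lemma emeasure_PiM_lborel_box:
  fixes b :: "nat \<Rightarrow> real"
  assumes "\<And>i. i < d \<Longrightarrow> 0 \<le> b i"
  shows "emeasure (Pi\<^sub>M {..<d} (\<lambda>_. lborel)) (Pi\<^sub>E {..<d} (\<lambda>i. {- b i..b i}))
    = ennreal (\<Prod>i<d. 2 * b i)"
proof -
  interpret product_sigma_finite "\<lambda>_::nat. lborel :: real measure"
    by standard
  have "emeasure (Pi\<^sub>M {..<d} (\<lambda>_. lborel)) (Pi\<^sub>E {..<d} (\<lambda>i. {- b i..b i}))
      = (\<Prod>i<d. emeasure lborel {- b i..b i})"
    by (rule emeasure_PiM) auto
  also have "\<dots> = (\<Prod>i<d. ennreal (2 * b i))"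
    using assms by (intro prod.cong) auto
  also have "\<dots> = ennreal (\<Prod>i<d. 2 * b i)"
    using assms by (intro prod_ennreal) auto
  finally show ?thesis .
qed

lemma vol_ge_box:
  assumes K: "convex_body d K" and b: "\<And>i. i < d \<Longrightarrow> 0 \<le> b i"
    and box: "\<And>x. (\<And>i. i < d \<Longrightarrow> \<bar>x i\<bar> \<le> b i) \<Longrightarrow> (\<And>i. i \<ge> d \<Longrightarrow> x i = 0) \<Longrightarrow> x \<in> K"
  shows "(\<Prod>i<d. 2 * b i) \<le> vol d K"
proof -
  let ?M = "Pi\<^sub>M {..<d} (\<lambda>_. lborel :: real measure)"
  let ?K = "(\<lambda>x. restrict x {..<d}) ` K"
  let ?B = "Pi\<^sub>E {..<d} (\<lambda>i. {- b i..b i})"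
  have Kmeas: "?K \<in> sets ?M"
    by (rule sets_restrict_compact[OF compact_if_convex_body[OF K] convex_body_subset[OF K]])
  have "?B \<subseteq> ?K"
  proof
    fix y assume y: "y \<in> ?B"
    let ?x = "\<lambda>i. if i < d then y i else 0"
    have yb: "\<bar>y i\<bar> \<le> b i" if "i < d" for i
      using PiE_mem[OF y, of i] that by auto
    have "?x \<in> K"
      by (rule box) (auto simp: yb)
    moreover have "y = restrict ?x {..<d}"
      using y by (auto simp: fun_eq_iff PiE_def extensional_def)
    ultimately show "y \<in> ?K"
      by blast
  qed
  then have "emeasure ?M ?B \<le> emeasure ?M ?K"
    using Kmeas by (rule emeasure_mono)
  then have le: "ennreal (\<Prod>i<d. 2 * b i) \<le> emeasure ?M ?K"
    using b by (simp add: emeasure_PiM_lborel_box)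
  \<comment> \<open>\<open>vol\<close> is a \<open>measure\<close>, which would be 0 on a set of
    infinite measure; an enclosing box excludes this.\<close>
  obtain R where R: "\<And>x i. x \<in> K \<Longrightarrow> i < d \<Longrightarrow> \<bar>x i\<bar> \<le> R"
    using compact_coordinate_bound[OF compact_if_convex_body[OF K]] by blast
  \<comment> \<open>The absolute value is taken because \<open>R\<close> may be negative when
    \<open>K\<close> is empty or \<open>d = 0\<close>, while the box formula needs nonnegative
    half-lengths.\<close>
  have "?K \<subseteq> Pi\<^sub>E {..<d} (\<lambda>i. {- \<bar>R\<bar>..\<bar>R\<bar>})"
  proof (intro image_subsetI restrict_PiE_iff[THEN iffD2] ballI)
    fix x i assume "x \<in> K" "i \<in> {..<d}"
    with R[of x i] show "x i \<in> {- \<bar>R\<bar>..\<bar>R\<bar>}"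
      by (simp add: abs_le_iff)
  qed
  then have "emeasure ?M ?K \<le> emeasure ?M (Pi\<^sub>E {..<d} (\<lambda>i. {- \<bar>R\<bar>..\<bar>R\<bar>}))"
    by (rule emeasure_mono) (intro sets_PiM_I_finite; simp)
  also have "\<dots> < top"
    by (simp add: emeasure_PiM_lborel_box)
  finally have "emeasure ?M ?K = ennreal (vol d K)"
    by (simp add: vol_def emeasure_eq_ennreal_measure)
  with le show ?thesis
    by (simp add: vol_def)
qed

section \<open>Selecting the smallest factors of a product\<close>

text \<open>Greedy choice: each induction step adds a minimiser of \<open>a\<close> among the
  remaining elements.\<close>

lemma exists_smallest_subset:
  fixes a :: "'a \<Rightarrow> 'b::linorder"
  assumes "finite S" "k \<le> card S"
  shows "\<exists>I\<subseteq>S. card I = k \<and> (\<forall>i\<in>I. \<forall>j\<in>S - I. a i \<le> a j)"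
  using assms(2)
proof (induction k)
  case (Suc k)
  then obtain I where I: "I \<subseteq> S" "card I = k" "\<forall>i\<in>I. \<forall>j\<in>S - I. a i \<le> a j"
    by (meson Suc_leD)
  have finI: "finite I"
    using I assms(1) finite_subset by blast
  have "S - I \<noteq> {}"
    using card_mono[OF finI, of S] I(2) Suc.prems by auto
  then obtain s where s: "s \<in> S - I" "\<forall>j\<in>S - I. a s \<le> a j"
    using assms(1) ex_is_arg_min_if_finite[of "S - I" a]
    by (auto simp: is_arg_min_linorder)
  have "card (insert s I) = Suc k"
    using s I finI by simp
  moreover have "\<forall>i\<in>insert s I. \<forall>j\<in>S - insert s I. a i \<le> a j"
    using I s by auto
  ultimately show ?case
    using I(1) s(1) by (intro exI[of _ "insert s I"]) simp
qed (intro exI[of _ "{}"]; simp)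

text \<open>The geometric mean of the \<open>k\<close> smallest numbers is at most that of all of
  them, written with integer powers to avoid roots.\<close>

lemma exists_subset_prod_le:
  fixes a :: "'a \<Rightarrow> real"
  assumes S: "finite S" and k: "k \<le> card S" and a: "\<And>i. i \<in> S \<Longrightarrow> 0 < a i"
  shows "\<exists>I\<subseteq>S. card I = k \<and> (\<Prod>i\<in>I. a i) ^ card S \<le> (\<Prod>i\<in>S. a i) ^ k"
proof -
  obtain I where I: "I \<subseteq> S" "card I = k" "\<And>i j. i \<in> I \<Longrightarrow> j \<in> S - I \<Longrightarrow> a i \<le> a j"
    using exists_smallest_subset[OF S k, of a] by blast
  let ?P = "\<Prod>i\<in>I. a i" and ?Q = "\<Prod>i\<in>S - I. a i"
  have finI: "finite I"
    using I S finite_subset by blast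
  have P0: "?P > 0"
    using I a by (intro prod_pos) auto
  have cardD: "card (S - I) = card S - k"
    using I finI card_Diff_subset by blast
  \<comment> \<open>Both sides become products over all pairs from \<open>I\<close> and
    \<open>S - I\<close>, where the smaller factor \<open>a i\<close> is replaced by
    \<open>a j\<close>.\<close>
  have "?P ^ card (S - I) = (\<Prod>j\<in>S - I. \<Prod>i\<in>I. a i)"
    by simp
  also have "\<dots> \<le> (\<Prod>j\<in>S - I. \<Prod>i\<in>I. a j)"
    using I(1,3) less_imp_le[OF a] by (intro prod_mono conjI prod_nonneg) auto
  also have "\<dots> = ?Q ^ k"
    using I by (simp add: prod_power_distrib)
  finally have "?P ^ k * ?P ^ card (S - I) \<le> ?P ^ k * ?Q ^ k"
    using P0 by (intro mult_left_mono) auto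
  moreover have "?P ^ k * ?P ^ card (S - I) = ?P ^ card S"
    using k by (simp add: cardD flip: power_add)
  moreover have "?P ^ k * ?Q ^ k = (\<Prod>i\<in>S. a i) ^ k"
    using prod.subset_diff[OF I(1) S, of a] by (simp add: power_mult_distrib mult.commute)
  ultimately show ?thesis
    using I by auto
qed

section \<open>Integer radii along the axes\<close>

text \<open>\<open>n\<close> is the maximum of the absolute \<open>i\<close>-th coordinates of
  lattice points in \<open>K\<close>. A point attaining it supplies the segment, and a point with
  nonzero \<open>i\<close>-th coordinate excludes \<open>n = 0\<close>.\<close>

lemma coordinate_radius:
  assumes K: "convex_body d K" "unconditional K" and dim: "affine_hull_dim (K \<inter> int_lattice d) = d"
    and i: "i < d"
  shows "\<exists>n::nat. n \<ge> 1 \<and> (\<forall>t. \<bar>t\<bar> \<le> real n \<longrightarrow> t *\<^sub>R unit_fun i \<in> K) \<and>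
    (\<forall>x\<in>K \<inter> int_lattice d. \<bar>x i\<bar> \<le> real n)"
proof -
  let ?A = "K \<inter> int_lattice d"
  obtain z where z: "z \<in> ?A" "z i \<noteq> 0"
    using exists_nonzero_coordinate[OF dim _ i] by (auto simp: int_lattice_def)
  have fin: "finite ((\<lambda>x. \<bar>x i\<bar>) ` ?A)"
    using finite_lattice_points[OF K(1)] by blast
  then have "Max ((\<lambda>x. \<bar>x i\<bar>) ` ?A) \<in> (\<lambda>x. \<bar>x i\<bar>) ` ?A"
    using z by (intro Max_in) auto
  then obtain w where w: "w \<in> ?A" "Max ((\<lambda>x. \<bar>x i\<bar>) ` ?A) = \<bar>w i\<bar>"
    by auto
  have max: "\<bar>x i\<bar> \<le> \<bar>w i\<bar>" if "x \<in> ?A" for x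
    using Max_ge[OF fin] that by (metis imageI w(2))
  have "w i \<in> \<int>"
    using w by (auto simp: int_lattice_def)
  then obtain n where n: "\<bar>w i\<bar> = real n"
    by (metis Ints_abs Ints_cases abs_ge_zero of_int_0_le_iff of_int_of_nat_eq zero_le_imp_eq_int)
  have "n \<ge> 1"
    using max[OF z(1)] z(2) n by (cases n) auto
  moreover have "t *\<^sub>R unit_fun i \<in> K" if "\<bar>t\<bar> \<le> real n" for t
    using w K n that by (intro unconditional_axis_segment[of K w]) (auto simp: convex_body_def)
  ultimately show ?thesis
    using max n by auto
qed

section \<open>Combining the volume and fibre estimates\<close>

theorem theorem9:
  shows "\<exists>C::real. C > 0 \<and>
    (\<forall>(d::nat) (m::nat) (K :: (nat \<Rightarrow> real) set).
       d \<ge> 1 \<longrightarrow> 1 \<le> m \<longrightarrow> m \<le> d \<longrightarrow>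
       convex_body d K \<longrightarrow> unconditional K \<longrightarrow>
       affine_hull_dim (K \<inter> int_lattice d) = d \<longrightarrow>
       real (lattice_count d K)
         \<le> (C * real d) ^ (d - m)
           * real (Max {lattice_count d (K \<inter> H) |H. H \<in> lattice_subspaces m d})
           * vol d K powr (real (d - m) / real d))"
proof (intro exI conjI allI impI)
  \<comment> \<open>The 3 comes from \<open>2 * a i + 1 \<le> 3 * a i\<close>, the 2 from the side
    lengths \<open>2 * (a i / d)\<close> of the inscribed box.\<close>
  show "(0::real) < 3/2"
    by simp
  fix d m :: nat and K :: "(nat \<Rightarrow> real) set"
  assume d: "d \<ge> 1" and "1 \<le> m" and m: "m \<le> d"
    and K: "convex_body d K" and unc: "unconditional K"
    and dim: "affine_hull_dim (K \<inter> int_lattice d) = d"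
  define k where "k = d - m"
  let ?Max = "Max {lattice_count d (K \<inter> H) |H. H \<in> lattice_subspaces m d}"
  have conv: "convex K"
    using K by (simp add: convex_body_def)
  have fin: "finite (K \<inter> int_lattice d)"
    by (rule finite_lattice_points[OF K])
  have "\<forall>i. \<exists>n::nat. i < d \<longrightarrow> n \<ge> 1 \<and> (\<forall>t. \<bar>t\<bar> \<le> real n \<longrightarrow> t *\<^sub>R unit_fun i \<in> K) \<and>
    (\<forall>x\<in>K \<inter> int_lattice d. \<bar>x i\<bar> \<le> real n)"
    using coordinate_radius[OF K unc dim] by blast
  then obtain a :: "nat \<Rightarrow> nat" where a1: "\<And>i. i < d \<Longrightarrow> a i \<ge> 1"
    and seg: "\<And>i t. i < d \<Longrightarrow> \<bar>t\<bar> \<le> real (a i) \<Longrightarrow> t *\<^sub>R unit_fun i \<in> K"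
    and bound: "\<And>i x. i < d \<Longrightarrow> x \<in> K \<inter> int_lattice d \<Longrightarrow> \<bar>x i\<bar> \<le> real (a i)"
    by metis

  have "(\<Prod>i<d. 2 * (real (a i) / real d)) \<le> vol d K"
  proof (rule vol_ge_box[OF K])
    fix x :: "nat \<Rightarrow> real"
    assume "\<And>i. i < d \<Longrightarrow> \<bar>x i\<bar> \<le> real (a i) / real d" "\<And>i. i \<ge> d \<Longrightarrow> x i = 0"
    then show "x \<in> K"
      using convex_unconditional_contains_box[OF conv d, of "\<lambda>i. real (a i)" x] seg by blast
  qed simp
  moreover have "(\<Prod>i<d. real (a i)) = (\<Prod>i<d. (real d / 2) * (2 * (real (a i) / real d)))"
    using d by (intro prod.cong) auto
  ultimately have vol: "(\<Prod>i<d. real (a i)) \<le> (real d / 2) ^ d * vol d K"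
    by (simp only: prod.distrib prod_constant card_lessThan) (intro mult_left_mono; simp)
  \<comment> \<open>Strict positivity of the volume is what permits converting \<open>powr\<close>
    into integer powers below, including the value 1 at exponent 0 when
    \<open>m = d\<close>.\<close>
  have "0 < (\<Prod>i<d. real (a i))"
    using a1 by (intro prod_pos) (auto simp: Suc_le_eq)
  with vol have "0 < (real d / 2) ^ d * vol d K"
    by linarith
  with d have volpos: "0 < vol d K"
    by (simp add: zero_less_mult_iff)

  have "\<exists>I\<subseteq>{..<d}. card I = k \<and>
      (\<Prod>i\<in>I. real (a i)) ^ card {..<d} \<le> (\<Prod>i<d. real (a i)) ^ k"
    using a1 by (intro exists_subset_prod_le) (auto simp: k_def Suc_le_eq)
  then obtain I where I: "I \<subseteq> {..<d}" "card I = k"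
    and prod_I: "(\<Prod>i\<in>I. real (a i)) ^ d \<le> (\<Prod>i<d. real (a i)) ^ k"
    by auto
  have finI: "finite I"
    using I finite_subset by blast
  let ?P = "\<Prod>i\<in>I. real (a i)"
  have "?P ^ d \<le> ((real d / 2) ^ d * vol d K) ^ k"
    using prod_I vol by (meson order_trans power_mono prod_nonneg of_nat_0_le_iff)
  \<comment> \<open>The bound is rewritten as a \<open>d\<close>-th power so that monotonicity of
    powers can remove the exponent from both sides.\<close>
  also have "\<dots> = ((real d / 2) ^ k * vol d K powr (real k / real d)) ^ d"
  proof -
    have "vol d K ^ k = (vol d K powr (real k / real d)) ^ d"
      using d volpos by (simp add: powr_power powr_realpow)
    moreover have "((real d / 2) ^ d) ^ k = ((real d / 2) ^ k) ^ d"
      by (metis mult.commute power_mult)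
    ultimately show ?thesis
      by (simp only: power_mult_distrib)
  qed
  finally have P: "?P \<le> (real d / 2) ^ k * vol d K powr (real k / real d)"
    using d by (subst (asm) power_mono_iff) (auto intro!: prod_nonneg)

  have "real (\<Prod>i\<in>I. 2 * a i + 1) \<le> (\<Prod>i\<in>I. 3 * real (a i))"
    unfolding of_nat_prod using I a1 by (intro prod_mono) force
  also have "\<dots> = 3 ^ k * ?P"
    using I by (simp add: prod.distrib)
  also have "\<dots> \<le> 3 ^ k * ((real d / 2) ^ k * vol d K powr (real k / real d))"
    using P by (intro mult_left_mono) auto
  also have "\<dots> = (3/2 * real d) ^ k * vol d K powr (real k / real d)"
    by (simp add: power_mult_distrib power_divide)
  finally have fibre: "real (\<Prod>i\<in>I. 2 * a i + 1)
    \<le> (3/2 * real d) ^ k * vol d K powr (real k / real d)" .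

  let ?J = "{..<d} - I"
  have "card ?J = m"
    using I finI m by (simp add: card_Diff_subset k_def)
  then have H: "coord_space ?J \<in> lattice_subspaces m d"
    using coord_space_in_lattice_subspaces[of ?J d] by auto
  \<comment> \<open>There may be infinitely many subspaces, but the counts are bounded by that of
    \<open>K\<close>. Hence the set of values is finite and \<open>Max\<close> is an actual upper
    bound.\<close>
  have "lattice_count d (K \<inter> H) \<le> lattice_count d K" for H
    unfolding lattice_count_def by (rule card_mono[OF fin]) blast
  then have "{lattice_count d (K \<inter> H) |H. H \<in> lattice_subspaces m d} \<subseteq> {..lattice_count d K}"
    by auto
  then have "finite {lattice_count d (K \<inter> H) |H. H \<in> lattice_subspaces m d}"
    by (rule finite_subset) simp
  then have "lattice_count d (K \<inter> coord_space ?J) \<le> ?Max"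
    using H by (auto intro: Max_ge)
  moreover have "lattice_count d K
      \<le> lattice_count d (K \<inter> coord_space ?J) * (\<Prod>i\<in>I. 2 * a i + 1)"
    by (rule lattice_count_le_fibres[OF unc conv fin I(1)]) (use I(1) bound in blast)
  ultimately have "lattice_count d K \<le> ?Max * (\<Prod>i\<in>I. 2 * a i + 1)"
    using mult_le_mono1 order_trans by blast
  then have "real (lattice_count d K) \<le> real ?Max * real (\<Prod>i\<in>I. 2 * a i + 1)"
    by (simp only: of_nat_le_iff flip: of_nat_mult)
  also have "\<dots> \<le> real ?Max * ((3/2 * real d) ^ k * vol d K powr (real k / real d))"
    using fibre by (intro mult_left_mono) auto
  finally show "real (lattice_count d K)
      \<le> (3/2 * real d) ^ (d - m) * real ?Max * vol d K powr (real (d - m) / real d)"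
    by (simp add: k_def mult_ac)
qed

end
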